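(* Let $\Lambda=\{(W_j,\Lambda_j,v_j)\}_{j\in J}$ be a g-fusion frame for $H$ with respect to $\{H_j\}_{j\in J}$ with frame bounds $C,D$ ($C$ lower, $D$ upper), and for each $j\in J$ let $T_j:H\to H_j$ be a bounded operator such that $\{v_j^2\,P_{W_j}\Lambda_j^*T_j\}_{j\in J}$ is a resolution of the identity operator on $H$. Then for all $f\in H$, $$\frac1D\left\|\sum_{j\in J}v_j^2P_{W_j}\Lambda_j^*T_j(f)\right\|^2\le\sum_{j\in J}v_j^2\|T_j(f)\|^2 .$$
   Context: $H$ is a separable Hilbert space, $J\subseteq\mathbb Z$, $\{H_j\}_{j\in J}$ is a collection of Hilbert spaces, and $\mathcal B(H_1,H_2)$ is the space of bounded linear operators from $H_1$ to $H_2$. For a closed subspace $V\subset H$, $P_V$ is the orthogonal projection of $H$ onto $V$. Let $\{W_j\}_{j\in J}$ be closed subspaces of $H$, $v_j>0$ weights and $\Lambda_j\in\mathcal B(H,H_j)$ for $j\in J$. The family $\Lambda=\{(W_j,\Lambda_j,v_j)\}_{j\in J}$ is a g-fusion frame for $H$ with respect to $\{H_j\}_{j\in J}$ with bounds $A$ (lower) and $B$ (upper), $0<A\le B<\infty$, if $A\|f\|^2\le\sum_{j\in J}v_j^2\|\Lambda_jP_{W_j}(f)\|^2\le B\|f\|^2$ for all $f\in H$. A family $\{R_j\}_{j\in J}$ of bounded operators on $H$ is a resolution of the identity operator on $H$ if for all $f\in H$ one has $f=\sum_{j\in J}R_j(f)$ with the series converging unconditionally. A sum of nonnegative terms is understood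 in $[0,\infty]$. *)

theory Defs
  imports "HOL-Analysis.Analysis" "HOL-Algebra.Algebraic_Closure_Type"
begin

section \<open>The scalar field\<close>

text \<open>
  Scalars are real or complex. A real normed field \<open>'k\<close> with \<open>z * rc_cnj z = |z|\<^sup>2\<close> and
  \<open>rc_cnj\<close> additive is \<open>\<real>\<close> or \<open>\<complex>\<close>: expanding \<open>|z + 1|\<^sup>2\<close> shows that \<open>z + rc_cnj z\<close> is real, so
  every \<open>z\<close> is a root of a real quadratic.
\<close>

class rc_field = real_normed_field +
  fixes rc_cnj :: "'a \<Rightarrow> 'a"
  assumes rc_cnj_add: "rc_cnj (x + y) = rc_cnj x + rc_cnj y"
    and mult_rc_cnj: "x * rc_cnj x = (norm x)\<^sup>2 *\<^sub>R 1"

instantiation real :: rc_field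
begin
definition rc_cnj_real :: "real \<Rightarrow> real" where "rc_cnj_real x = x"
instance by standard (auto simp: rc_cnj_real_def power2_eq_square)
end

instantiation complex :: rc_field
begin
definition rc_cnj_complex :: "complex \<Rightarrow> complex" where "rc_cnj_complex = cnj"
instance by standard (simp_all add: rc_cnj_complex_def complex_norm_square [symmetric] scaleR_conv_of_real)
end


section \<open>Hilbert spaces\<close>

text \<open>
  Vector spaces are modules in the sense of HOL-Algebra over the scalar field, so that a family
  of different Hilbert spaces can be indexed by integers. As in the \<open>module\<close> record itself, the
  inherited \<open>mult\<close> and \<open>one\<close> fields play no role. The inner product is linear in the first
  argument.
\<close>

record ('k, 'a) hspace = "('k, 'a) module" +
  hinner :: "'a \<Rightarrow> 'a \<Rightarrow> 'k"

text \<open>\<open>hinner E x x\<close> is a nonnegative real in \<open>'k\<close>; \<open>norm\<close> only reads it off as a \<open>real\<close>.\<close>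

definition hnorm :: "('k::rc_field, 'a) hspace \<Rightarrow> 'a \<Rightarrow> real" where
  "hnorm E x = sqrt (norm (hinner E x x))"

text \<open>The locale \<open>Metric_space\<close> wants nonnegativity and symmetry also off the carrier.\<close>

definition hdist :: "('k::rc_field, 'a) hspace \<Rightarrow> 'a \<Rightarrow> 'a \<Rightarrow> real" where
  "hdist E x y = (if x \<in> carrier E \<and> y \<in> carrier E then hnorm E (x \<ominus>\<^bsub>E\<^esub> y) else 0)"

definition htopology :: "('k::rc_field, 'a) hspace \<Rightarrow> 'a topology" where
  "htopology E = Metric_space.mtopology (carrier E) (hdist E)"

locale hilbert_space =
  Module.module "ring_of_type_algebra :: 'k::rc_field ring" E
  for E :: "('k::rc_field, 'a) hspace" (structure) +
  assumes hinner_add_left: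
      "\<lbrakk>x \<in> carrier E; y \<in> carrier E; z \<in> carrier E\<rbrakk>
        \<Longrightarrow> hinner E (x \<oplus>\<^bsub>E\<^esub> y) z = hinner E x z + hinner E y z"
    and hinner_smult_left:
      "\<lbrakk>x \<in> carrier E; y \<in> carrier E\<rbrakk> \<Longrightarrow> hinner E (c \<odot>\<^bsub>E\<^esub> x) y = c * hinner E x y"
    and hinner_commute:
      "\<lbrakk>x \<in> carrier E; y \<in> carrier E\<rbrakk> \<Longrightarrow> hinner E x y = rc_cnj (hinner E y x)"
    and hinner_nonneg:
      "x \<in> carrier E \<Longrightarrow> \<exists>r\<ge>0. hinner E x x = of_real r"
    and hinner_eq_zero:
      "\<lbrakk>x \<in> carrier E; hinner E x x = 0\<rbrakk> \<Longrightarrow> x = \<zero>\<^bsub>E\<^esub>"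
    and complete:
      "Metric_space.mcomplete (carrier E) (hdist E)"

definition closed_subspace :: "('k::rc_field, 'a) hspace \<Rightarrow> 'a set \<Rightarrow> bool" where
  "closed_subspace E V \<longleftrightarrow>
     submodule V (ring_of_type_algebra :: 'k ring) E \<and> closedin (htopology E) V"

definition bounded_op ::
    "('k::rc_field, 'a) hspace \<Rightarrow> ('k, 'b) hspace \<Rightarrow> ('a \<Rightarrow> 'b) \<Rightarrow> bool" where
  "bounded_op E G T \<longleftrightarrow>
     T \<in> carrier E \<rightarrow> carrier G \<and>
     (\<forall>x\<in>carrier E. \<forall>y\<in>carrier E. T (x \<oplus>\<^bsub>E\<^esub> y) = T x \<oplus>\<^bsub>G\<^esub> T y) \<and>
     (\<forall>c. \<forall>x\<in>carrier E. T (c \<odot>\<^bsub>E\<^esub> x) = c \<odot>\<^bsub>G\<^esub> T x) \<and>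
     (\<exists>M. \<forall>x\<in>carrier E. hnorm G (T x) \<le> M * hnorm E x)"

definition hadjoint ::
    "('k::rc_field, 'a) hspace \<Rightarrow> ('k, 'b) hspace \<Rightarrow> ('a \<Rightarrow> 'b) \<Rightarrow> 'b \<Rightarrow> 'a" where
  "hadjoint E G T y =
     (THE z. z \<in> carrier E \<and> (\<forall>x\<in>carrier E. hinner G (T x) y = hinner E x z))"

definition hproj :: "('k::rc_field, 'a) hspace \<Rightarrow> 'a set \<Rightarrow> 'a \<Rightarrow> 'a" where
  "hproj E V x = (THE p. p \<in> V \<and> (\<forall>v\<in>V. hinner E (x \<ominus>\<^bsub>E\<^esub> p) v = 0))"


section \<open>Unconditional sums\<close>

text \<open>Unconditional convergence is convergence of the net of finite partial sums, as in \<open>has_sum\<close>.\<close>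

definition has_hsum ::
    "('k::rc_field, 'a) hspace \<Rightarrow> ('i \<Rightarrow> 'a) \<Rightarrow> 'i set \<Rightarrow> 'a \<Rightarrow> bool" where
  "has_hsum E g J s \<longleftrightarrow>
     g \<in> J \<rightarrow> carrier E \<and>
     limitin (htopology E) (\<lambda>F. finsum E g F) s (finite_subsets_at_top J)"

definition hsum :: "('k::rc_field, 'a) hspace \<Rightarrow> ('i \<Rightarrow> 'a) \<Rightarrow> 'i set \<Rightarrow> 'a" where
  "hsum E g J = (THE s. has_hsum E g J s)"

definition resolution_of_identity ::
    "('k::rc_field, 'a) hspace \<Rightarrow> 'i set \<Rightarrow> ('i \<Rightarrow> 'a \<Rightarrow> 'a) \<Rightarrow> bool" where
  "resolution_of_identity E J R \<longleftrightarrow>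
     (\<forall>j\<in>J. bounded_op E E (R j)) \<and>
     (\<forall>f\<in>carrier E. has_hsum E (\<lambda>j. R j f) J f)"


section \<open>g-fusion frames\<close>

definition g_fusion_frame ::
    "('k::rc_field, 'a) hspace \<Rightarrow> int set \<Rightarrow> (int \<Rightarrow> ('k, 'b) hspace) \<Rightarrow> (int \<Rightarrow> 'a set)
      \<Rightarrow> (int \<Rightarrow> 'a \<Rightarrow> 'b) \<Rightarrow> (int \<Rightarrow> real) \<Rightarrow> real \<Rightarrow> real \<Rightarrow> bool" where
  "g_fusion_frame H J Hs W \<Lambda> v A B \<longleftrightarrow>
     (\<forall>j\<in>J. closed_subspace H (W j) \<and> bounded_op H (Hs j) (\<Lambda> j) \<and> v j > 0) \<and>
     0 < A \<and> A \<le> B \<and>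
     (\<forall>f\<in>carrier H.
        ennreal (A * (hnorm H f)\<^sup>2)
          \<le> (\<Sum>\<^sub>\<infinity>j\<in>J. ennreal ((v j)\<^sup>2 * (hnorm (Hs j) (\<Lambda> j (hproj H (W j) f)))\<^sup>2)) \<and>
        (\<Sum>\<^sub>\<infinity>j\<in>J. ennreal ((v j)\<^sup>2 * (hnorm (Hs j) (\<Lambda> j (hproj H (W j) f)))\<^sup>2))
          \<le> ennreal (B * (hnorm H f)\<^sup>2))"

definition weighted_op ::
    "('k::rc_field, 'a) hspace \<Rightarrow> (int \<Rightarrow> ('k, 'b) hspace) \<Rightarrow> (int \<Rightarrow> 'a set)
      \<Rightarrow> (int \<Rightarrow> 'a \<Rightarrow> 'b) \<Rightarrow> (int \<Rightarrow> real) \<Rightarrow> (int \<Rightarrow> 'a \<Rightarrow> 'b) \<Rightarrow> int \<Rightarrow> 'a \<Rightarrow> 'a" where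
  "weighted_op H Hs W \<Lambda> v T j f =
     of_real ((v j)\<^sup>2) \<odot>\<^bsub>H\<^esub> hproj H (W j) (hadjoint H (Hs j) (\<Lambda> j) (T j f))"

end

theory Submission
  imports Defs
begin

text \<open>
  Write \<open>P\<^sub>j\<close> for the projection onto \<open>W j\<close> and let \<open>S = \<Sum>\<^sub>j\<^sub>\<in>\<^sub>F v\<^sub>j\<^sup>2 P\<^sub>j \<Lambda>\<^sub>j\<^sup>* T\<^sub>j f\<close> be a partial
  sum over a finite \<open>F \<subseteq> J\<close>. Moving \<open>P\<^sub>j\<close> and \<open>\<Lambda>\<^sub>j\<^sup>*\<close> to the other side of the inner product gives
  \<open>\<parallel>S\<parallel>\<^sup>2 = \<Sum>\<^sub>j\<^sub>\<in>\<^sub>F v\<^sub>j\<^sup>2 \<langle>T\<^sub>j f, \<Lambda>\<^sub>j P\<^sub>j S\<rangle>\<close>. The Cauchy-Schwarz inequality, in each space \<open>Hs j\<close> and then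
  for the sum, bounds this by \<open>\<surd>(\<Sum>\<^sub>j v\<^sub>j\<^sup>2 \<parallel>\<Lambda>\<^sub>j P\<^sub>j S\<parallel>\<^sup>2) \<surd>(\<Sum>\<^sub>j v\<^sub>j\<^sup>2 \<parallel>T\<^sub>j f\<parallel>\<^sup>2)\<close>. The upper frame bound
  at \<open>S\<close> makes the first factor at most \<open>\<surd>D \<parallel>S\<parallel>\<close>, and cancelling \<open>\<parallel>S\<parallel>\<close> leaves
  \<open>\<parallel>S\<parallel>\<^sup>2 \<le> D \<Sum>\<^sub>j v\<^sub>j\<^sup>2 \<parallel>T\<^sub>j f\<parallel>\<^sup>2\<close> (\<open>synthesis_bound\<close>). The bound does not depend on \<open>F\<close>, so it
  passes to the limit \<open>f\<close> of the partial sums (\<open>has_hsum_hnorm_le\<close>).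

  Projections, adjoints and sums are given by definite descriptions, so their properties rest on
  existence and uniqueness theorems for carrier-based Hilbert spaces: the closest point of a
  closed subspace (\<open>ex_closest_point\<close>), its orthogonality (\<open>closest_point_orthogonal\<close>), the Riesz
  representation theorem (\<open>ex_riesz_representation\<close>), and uniqueness of limits in the metric of
  the norm (\<open>has_hsum_unique\<close>).
\<close>

section \<open>Conjugation\<close>

lemma mult_rc_cnj_of_real: "x * rc_cnj x = of_real ((norm x)\<^sup>2)" for x :: "'k::rc_field"
  by (simp add: mult_rc_cnj of_real_def)

lemma rc_cnj_zero [simp]: "rc_cnj (0::'k::rc_field) = 0"
  using rc_cnj_add[of "0::'k" 0] by simp

text \<open>
  The equation \<open>x * rc_cnj x = \<bar>x\<bar>\<^sup>2\<close> determines the conjugate, so multiplicativity, isometry and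
  involutivity of \<open>rc_cnj\<close> can all be read off this quotient.
\<close>

lemma rc_cnj_eq_divide: "rc_cnj x = of_real ((norm x)\<^sup>2) / x" for x :: "'k::rc_field"
  using mult_rc_cnj_of_real[of x] by (cases "x = 0") (auto simp: field_simps)

lemma rc_cnj_mult [simp]: "rc_cnj (x * y) = rc_cnj x * rc_cnj y" for x y :: "'k::rc_field"
  by (simp add: rc_cnj_eq_divide norm_mult power_mult_distrib)

lemma rc_cnj_of_real [simp]: "rc_cnj (of_real r :: 'k::rc_field) = of_real r"
  by (cases "r = 0") (simp_all add: rc_cnj_eq_divide power2_eq_square)

lemma norm_rc_cnj [simp]: "norm (rc_cnj x) = norm x" for x :: "'k::rc_field"
  by (cases "x = 0") (simp_all add: rc_cnj_eq_divide norm_divide norm_mult power2_eq_square)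

lemma rc_cnj_rc_cnj [simp]: "rc_cnj (rc_cnj x) = x" for x :: "'k::rc_field"
proof (cases "x = 0")
  case False
  then show ?thesis
    unfolding rc_cnj_eq_divide[of "rc_cnj x"] norm_rc_cnj
    by (simp add: rc_cnj_eq_divide)
qed simp

section \<open>Norm and metric of a Hilbert space\<close>

context hilbert_space
begin

lemma carrier_scalars [simp]: "carrier (ring_of_type_algebra :: 'k ring) = UNIV"
  and add_scalars [simp]: "x \<oplus>\<^bsub>ring_of_type_algebra\<^esub> y = (x + y :: 'k)"
  and mult_scalars [simp]: "x \<otimes>\<^bsub>ring_of_type_algebra\<^esub> y = (x * y :: 'k)"
  and zero_scalars [simp]: "\<zero>\<^bsub>ring_of_type_algebra\<^esub> = (0 :: 'k)"
  and one_scalars [simp]: "\<one>\<^bsub>ring_of_type_algebra\<^esub> = (1 :: 'k)"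
  by (simp_all add: ring_of_type_algebra_def)

lemma smult_carrier [simp]: "x \<in> carrier E \<Longrightarrow> (c::'k) \<odot> x \<in> carrier E"
  by (rule smult_closed) simp_all

lemma smult_minus_one: "x \<in> carrier E \<Longrightarrow> (- 1 :: 'k) \<odot> x = \<ominus> x"
proof -
  assume x: "x \<in> carrier E"
  have "(- 1 :: 'k) \<odot> x \<oplus> x = (- 1 + 1 :: 'k) \<odot> x"
    using x smult_l_distr[of "-1" 1 x] smult_one[OF x] by simp
  also have "\<dots> = \<zero>" using smult_l_null[OF x] by simp
  finally show ?thesis
    using x by (metis M.minus_equality smult_carrier)
qed

lemma hinner_zero_left [simp]: "y \<in> carrier E \<Longrightarrow> hinner E \<zero> y = 0"
  using hinner_add_left[of \<zero> \<zero> y] by simp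

lemma hinner_minus_left: 
  "x \<in> carrier E \<Longrightarrow> y \<in> carrier E \<Longrightarrow> hinner E (\<ominus> x) y = - hinner E x y"
  using hinner_smult_left[of x y "-1"] by (simp add: smult_minus_one)

lemma hinner_diff_left:
  "\<lbrakk>x \<in> carrier E; y \<in> carrier E; z \<in> carrier E\<rbrakk>
    \<Longrightarrow> hinner E (x \<ominus> y) z = hinner E x z - hinner E y z"
  by (simp add: a_minus_def hinner_add_left hinner_minus_left)

lemma hinner_add_right:
  "\<lbrakk>x \<in> carrier E; y \<in> carrier E; z \<in> carrier E\<rbrakk>
    \<Longrightarrow> hinner E z (x \<oplus> y) = hinner E z x + hinner E z y"
  by (simp add: hinner_commute[of z] hinner_add_left rc_cnj_add)

lemma hinner_smult_right:
  "\<lbrakk>x \<in> carrier E; y \<in> carrier E\<rbrakk> \<Longrightarrow> hinner E x (c \<odot> y) = rc_cnj c * hinner E x y"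
  by (simp add: hinner_commute[of x] hinner_smult_left)

lemma hinner_zero_right [simp]: "y \<in> carrier E \<Longrightarrow> hinner E y \<zero> = 0"
  using hinner_commute[of y \<zero>] by simp

lemma hinner_minus_right: 
  "x \<in> carrier E \<Longrightarrow> y \<in> carrier E \<Longrightarrow> hinner E y (\<ominus> x) = - hinner E y x"
  using hinner_smult_right[of y x "-1"] rc_cnj_of_real[of "-1", where 'k='k]
  by (simp add: smult_minus_one)

lemma hinner_diff_right:
  "\<lbrakk>x \<in> carrier E; y \<in> carrier E; z \<in> carrier E\<rbrakk>
    \<Longrightarrow> hinner E z (x \<ominus> y) = hinner E z x - hinner E z y"
  by (simp add: a_minus_def hinner_add_right hinner_minus_right)

lemma hnorm_nonneg [simp]: "0 \<le> hnorm E x"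
  by (simp add: hnorm_def)

lemma hnorm_zero [simp]: "hnorm E \<zero> = 0"
  by (simp add: hnorm_def)

lemma hinner_self: "x \<in> carrier E \<Longrightarrow> hinner E x x = of_real ((hnorm E x)\<^sup>2)"
  using hinner_nonneg[of x] by (auto simp: hnorm_def)

lemma hnorm_eq_zero_iff: "x \<in> carrier E \<Longrightarrow> hnorm E x = 0 \<longleftrightarrow> x = \<zero>"
  using hinner_eq_zero[of x] by (auto simp: hnorm_def)

lemma hnorm_smult: "x \<in> carrier E \<Longrightarrow> hnorm E (c \<odot> x) = norm c * hnorm E x"
  by (simp add: hnorm_def hinner_smult_left hinner_smult_right norm_mult real_sqrt_mult)

text \<open>
  Pythagoras for \<open>x\<close> and its component along \<open>y\<close>. The left side is nonnegative, which gives
  Cauchy-Schwarz; if zero is the multiple of \<open>y\<close> nearest to \<open>x\<close>, the subtracted term has to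
  vanish, which gives orthogonality of closest points.
\<close>

lemma hnorm_residual_sq:
  assumes x: "x \<in> carrier E" and y: "y \<in> carrier E" and "y \<noteq> \<zero>"
  shows "(hnorm E (x \<ominus> (hinner E x y / hinner E y y) \<odot> y))\<^sup>2
    = (hnorm E x)\<^sup>2 - (norm (hinner E x y))\<^sup>2 / (hnorm E y)\<^sup>2"
proof -
  define a where "a = hinner E x y"
  define r where "r = (hnorm E y)\<^sup>2"
  define c where "c = a / of_real r"
  have r: "r \<noteq> 0" using assms hnorm_eq_zero_iff[of y] by (simp add: r_def)
  have yy: "hinner E y y = of_real r" using hinner_self[OF y] by (simp add: r_def)
  have yx: "hinner E y x = rc_cnj a" using hinner_commute[OF y x] by (simp add: a_def)
  have "of_real ((hnorm E (x \<ominus> c \<odot> y))\<^sup>2) = hinner E (x \<ominus> c \<odot> y) (x \<ominus> c \<odot> y)"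
    using x y by (simp add: hinner_self)
  also have "\<dots> = hinner E x x - c * rc_cnj a - rc_cnj c * a + c * rc_cnj c * of_real r"
    using x y by (simp add: hinner_diff_left hinner_diff_right hinner_smult_left hinner_smult_right
        yy yx flip: a_def) (simp add: algebra_simps)
  also have "rc_cnj c = rc_cnj a / of_real r"
    using rc_cnj_mult[of a "of_real (1/r)"] rc_cnj_of_real[of "1/r", where 'k='k]
    by (simp add: c_def del: rc_cnj_of_real rc_cnj_mult)
  also have "hinner E x x - c * rc_cnj a - rc_cnj a / of_real r * a 
       + c * (rc_cnj a / of_real r) * of_real r = hinner E x x - a * rc_cnj a / of_real r"
    using r by (simp add: c_def field_simps)
  also have "\<dots> = of_real ((hnorm E x)\<^sup>2 - (norm a)\<^sup>2 / r)"
    using x by (simp add: hinner_self mult_rc_cnj_of_real)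
  finally show ?thesis
    unfolding of_real_eq_iff by (simp add: c_def a_def r_def yy flip: hinner_self[OF y])
qed

lemma hinner_Cauchy_Schwarz:
  assumes x: "x \<in> carrier E" and y: "y \<in> carrier E"
  shows "norm (hinner E x y) \<le> hnorm E x * hnorm E y"
proof (cases "y = \<zero>")
  case False
  then have "0 < (hnorm E y)\<^sup>2" using hnorm_eq_zero_iff[OF y] by simp
  moreover have "(norm (hinner E x y))\<^sup>2 / (hnorm E y)\<^sup>2 \<le> (hnorm E x)\<^sup>2"
    using hnorm_residual_sq[OF x y False] by (smt (verit) zero_le_power2)
  ultimately have "(norm (hinner E x y))\<^sup>2 \<le> (hnorm E x * hnorm E y)\<^sup>2"
    by (simp add: field_simps power_mult_distrib)
  then show ?thesis by (rule power2_le_imp_le) simp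
qed (use x in simp)

lemma parallelogram:
  assumes x: "x \<in> carrier E" and y: "y \<in> carrier E"
  shows "(hnorm E (x \<oplus> y))\<^sup>2 + (hnorm E (x \<ominus> y))\<^sup>2 = 2 * (hnorm E x)\<^sup>2 + 2 * (hnorm E y)\<^sup>2"
proof -
  have "of_real ((hnorm E (x \<oplus> y))\<^sup>2 + (hnorm E (x \<ominus> y))\<^sup>2)
     = hinner E (x \<oplus> y) (x \<oplus> y) + hinner E (x \<ominus> y) (x \<ominus> y)"
    using x y by (simp add: hinner_self)
  also have "\<dots> = 2 * hinner E x x + 2 * hinner E y y"
    using x y by (simp add: hinner_add_left hinner_add_right hinner_diff_left hinner_diff_right)
  also have "\<dots> = of_real (2 * (hnorm E x)\<^sup>2 + 2 * (hnorm E y)\<^sup>2)"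
    using x y by (simp add: hinner_self)
  finally show ?thesis by (simp only: of_real_eq_iff)
qed

lemma hnorm_triangle:
  assumes x: "x \<in> carrier E" and y: "y \<in> carrier E"
  shows "hnorm E (x \<oplus> y) \<le> hnorm E x + hnorm E y"
proof (rule power2_le_imp_le)
  have "(hnorm E (x \<oplus> y))\<^sup>2 = norm (hinner E (x \<oplus> y) (x \<oplus> y))"
    by (simp add: hnorm_def)
  also have "\<dots> = norm (hinner E x x + hinner E x y + hinner E y x + hinner E y y)"
    using x y by (simp add: hinner_add_left hinner_add_right algebra_simps)
  also have "\<dots> \<le> norm (hinner E x x) + norm (hinner E x y) + norm (hinner E y x) + norm (hinner E y y)"
    by (intro norm_triangle_le add_mono order_refl)
  also have "\<dots> \<le> (hnorm E x)\<^sup>2 + hnorm E x * hnorm E y + hnorm E y * hnorm E x + (hnorm E y)\<^sup>2"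
    using x y by (intro add_mono hinner_Cauchy_Schwarz) (simp_all add: hnorm_def)
  finally show "(hnorm E (x \<oplus> y))\<^sup>2 \<le> (hnorm E x + hnorm E y)\<^sup>2"
    by (simp add: power2_sum)
qed simp

lemma hnorm_uminus: "x \<in> carrier E \<Longrightarrow> hnorm E (\<ominus> x) = hnorm E x"
  using hnorm_smult[of x "-1"] by (simp add: smult_minus_one)

lemma hnorm_minus_commute:
  "x \<in> carrier E \<Longrightarrow> y \<in> carrier E \<Longrightarrow> hnorm E (x \<ominus> y) = hnorm E (y \<ominus> x)"
  using hnorm_uminus[of "x \<ominus> y"] by (simp add: a_minus_def M.minus_add M.a_comm)

lemma diff_add_diff:
  "\<lbrakk>x \<in> carrier E; y \<in> carrier E; z \<in> carrier E\<rbrakk> \<Longrightarrow> (x \<ominus> y) \<oplus> (y \<ominus> z) = x \<ominus> z"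
  by (simp add: a_minus_def M.a_assoc M.r_neg2 M.r_neg1)

lemma diff_diff_diff:
  "\<lbrakk>x \<in> carrier E; y \<in> carrier E; z \<in> carrier E\<rbrakk> \<Longrightarrow> (x \<ominus> z) \<ominus> (x \<ominus> y) = y \<ominus> z"
  using diff_add_diff[of y x z] 
  by (simp add: a_minus_def M.minus_add M.a_comm M.a_ac M.r_neg M.r_neg1 M.r_neg2)

lemma diff_eq_zero_iff:
  "\<lbrakk>x \<in> carrier E; y \<in> carrier E\<rbrakk> \<Longrightarrow> x \<ominus> y = \<zero> \<longleftrightarrow> x = y"
  using diff_add_diff[of x y \<zero>] by (auto simp: a_minus_def M.r_neg)

sublocale met: Metric_space "carrier E" "hdist E"
proof
  fix x y
  show "0 \<le> hdist E x y" by (simp add: hdist_def)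
  show "hdist E x y = hdist E y x" by (simp add: hdist_def hnorm_minus_commute)
next
  fix x y assume "x \<in> carrier E" "y \<in> carrier E"
  then show "hdist E x y = 0 \<longleftrightarrow> x = y" by (simp add: hdist_def hnorm_eq_zero_iff diff_eq_zero_iff)
next
  fix x y z assume xyz: "x \<in> carrier E" "y \<in> carrier E" "z \<in> carrier E"
  then show "hdist E x z \<le> hdist E x y + hdist E y z"
    using hnorm_triangle[of "x \<ominus> y" "y \<ominus> z"] by (simp add: hdist_def diff_add_diff)
qed

lemma scalar_double: "x \<in> carrier E \<Longrightarrow> (2::'k) \<odot> x = x \<oplus> x"
  using smult_l_distr[of 1 1 x] smult_one[of x] by simp

section \<open>Orthogonal projection\<close>

lemma closed_subspaceD:
  assumes "closed_subspace E V"
  shows "V \<subseteq> carrier E" and "x \<in> V \<Longrightarrow> y \<in> V \<Longrightarrow> x \<oplus> y \<in> V" and "x \<in> V \<Longrightarrow> (c::'k) \<odot> x \<in> V"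
    and "x \<in> V \<Longrightarrow> y \<in> V \<Longrightarrow> x \<ominus> y \<in> V" and "V \<noteq> {}"
  using submoduleE[of V] assms by (auto simp: closed_subspace_def a_minus_def)

lemma htopology_eq: "htopology E = met.mtopology"
  by (simp add: htopology_def)

text \<open>
  The parallelogram law for \<open>x \<ominus> y\<close> and \<open>x \<ominus> z\<close>: their sum is twice the difference of \<open>x\<close> and
  the midpoint of \<open>y\<close> and \<open>z\<close>. With \<open>d\<close> the squared distance of \<open>x\<close> from a subspace, it makes
  minimizing sequences in that subspace Cauchy.
\<close>

lemma midpoint_estimate:
  assumes x: "x \<in> carrier E" and y: "y \<in> carrier E" and z: "z \<in> carrier E"
    and d: "d \<le> (hnorm E (x \<ominus> (1/2 :: 'k) \<odot> (y \<oplus> z)))\<^sup>2"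
  shows "(hnorm E (y \<ominus> z))\<^sup>2 \<le> 2 * ((hnorm E (x \<ominus> y))\<^sup>2 - d) + 2 * ((hnorm E (x \<ominus> z))\<^sup>2 - d)"
proof -
  let ?w = "(1/2 :: 'k) \<odot> (y \<oplus> z)"
  have "(2::'k) \<odot> ?w = y \<oplus> z"
    using y z smult_assoc1[of 2 "1/2" "y \<oplus> z"] smult_one[of "y \<oplus> z"] by simp
  then have "?w \<oplus> ?w = y \<oplus> z"
    using y z by (simp add: scalar_double)
  then have "(2::'k) \<odot> (x \<ominus> ?w) = (x \<ominus> y) \<oplus> (x \<ominus> z)"
    using x y z by (simp add: scalar_double a_minus_def M.a_ac flip: M.minus_add)
  then have "4 * (hnorm E (x \<ominus> ?w))\<^sup>2 = (hnorm E ((x \<ominus> y) \<oplus> (x \<ominus> z)))\<^sup>2"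
    using hnorm_smult[of "x \<ominus> ?w" 2] x y z by (simp add: power_mult_distrib)
  moreover have "hnorm E (y \<ominus> z) = hnorm E ((x \<ominus> y) \<ominus> (x \<ominus> z))"
    using x y z by (simp add: diff_diff_diff hnorm_minus_commute)
  ultimately show ?thesis
    using parallelogram[of "x \<ominus> y" "x \<ominus> z"] d x y z by simp
qed

lemma ex_closest_point:
  assumes V: "closed_subspace E V" and x: "x \<in> carrier E"
  shows "\<exists>p\<in>V. \<forall>v\<in>V. hnorm E (x \<ominus> p) \<le> hnorm E (x \<ominus> v)"
proof -
  note [simp] = subsetD[OF closed_subspaceD(1)[OF V]] closed_subspaceD(2-4)[OF V]
  \<comment> \<open>Squared distances keep the parallelogram estimate free of square roots.\<close>
  define d where "d = (INF v\<in>V. (hnorm E (x \<ominus> v))\<^sup>2)"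
  have d_le: "d \<le> (hnorm E (x \<ominus> v))\<^sup>2" if "v \<in> V" for v
    unfolding d_def using that by (intro cINF_lower bdd_belowI2[of _ 0]) simp
  have "\<exists>v\<in>V. (hnorm E (x \<ominus> v))\<^sup>2 < d + 1 / Suc n" for n
    using cInf_lessD[of "(\<lambda>v. (hnorm E (x \<ominus> v))\<^sup>2) ` V" "d + 1 / Suc n"] closed_subspaceD(5)[OF V]
    by (simp add: d_def)
  then obtain s where sV [simp]: "\<And>n. s n \<in> V" 
    and s: "\<And>n. (hnorm E (x \<ominus> s n))\<^sup>2 < d + 1 / Suc n"
    by metis
  have close: "(hnorm E (s m \<ominus> s n))\<^sup>2 \<le> 2 / Suc m + 2 / Suc n" for m n
    using midpoint_estimate[OF x, of "s m" "s n" d] d_le s[of m] s[of n] by simp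
  have "met.MCauchy s"
    unfolding met.MCauchy_def
  proof (intro conjI allI impI)
    fix e :: real assume e: "0 < e"
    \<comment> \<open>The divisor 4 absorbs the two summands \<open>2 / Suc m\<close> and \<open>2 / Suc n\<close> of the squared distance.\<close>
    obtain N where N: "inverse (Suc N) < e\<^sup>2 / 4"
      using reals_Archimedean[of "e\<^sup>2 / 4"] e by auto
    show "\<exists>N. \<forall>m n. N \<le> m \<longrightarrow> N \<le> n \<longrightarrow> hdist E (s m) (s n) < e"
    proof (intro exI allI impI)
      fix m n assume mn: "N \<le> m" "N \<le> n"
      have "2 / Suc k \<le> 2 / real (Suc N)" if "N \<le> k" for k
        using that by (intro divide_left_mono) auto
      then have "(hnorm E (s m \<ominus> s n))\<^sup>2 \<le> 2 / Suc N + 2 / Suc N"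
        using close[of m n] mn by (smt (verit))
      also have "\<dots> = 4 * inverse (Suc N)" by (simp add: divide_inverse)
      also have "\<dots> < e\<^sup>2" using N by simp
      finally show "hdist E (s m) (s n) < e"
        using e by (simp add: hdist_def power2_less_imp_less)
    qed
  qed auto
  then obtain p where p: "limitin met.mtopology s p sequentially"
    using complete by (auto simp: met.mcomplete_def)
  have "p \<in> V"
    using V p sV unfolding closed_subspace_def htopology_eq met.metric_closedin_iff_sequentially_closed
    by blast
  have lim: "(\<lambda>n. sqrt (d + 1 / Suc n) + hdist E (s n) p) \<longlonglongrightarrow> sqrt (d + 0) + 0"
    using p LIMSEQ_Suc[OF lim_1_over_n]
    by (intro tendsto_intros) (auto simp: met.limitin_metric_dist_null)
  have "hnorm E (x \<ominus> p) \<le> sqrt (d + 1 / Suc n) + hdist E (s n) p" for n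
  proof -
    have "hnorm E (x \<ominus> p) \<le> hnorm E (x \<ominus> s n) + hnorm E (s n \<ominus> p)"
      using hnorm_triangle[of "x \<ominus> s n" "s n \<ominus> p"] x \<open>p \<in> V\<close> by (simp add: diff_add_diff)
    moreover have "hnorm E (x \<ominus> s n) \<le> sqrt (d + 1 / Suc n)"
      using s[of n] by (intro real_le_rsqrt) simp
    ultimately show ?thesis using \<open>p \<in> V\<close> by (simp add: hdist_def)
  qed
  then have "hnorm E (x \<ominus> p) \<le> sqrt d"
    using LIMSEQ_le_const[OF lim] by simp
  moreover have "sqrt d \<le> hnorm E (x \<ominus> v)" if "v \<in> V" for v
    using d_le[OF that] by (intro real_le_lsqrt) simp_all
  ultimately show ?thesis using \<open>p \<in> V\<close> by (meson order_trans)
qed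

text \<open>
  Moving from \<open>p\<close> along the component \<open>c \<odot> v\<close> of \<open>x \<ominus> p\<close> would reduce the distance to \<open>x\<close> unless
  that component is zero.
\<close>

lemma closest_point_orthogonal:
  assumes V: "closed_subspace E V" and x: "x \<in> carrier E" and p: "p \<in> V"
    and min: "\<And>v. v \<in> V \<Longrightarrow> hnorm E (x \<ominus> p) \<le> hnorm E (x \<ominus> v)" and v: "v \<in> V"
  shows "hinner E (x \<ominus> p) v = 0"
proof (cases "v = \<zero>")
  case True
  then show ?thesis using x p closed_subspaceD(1)[OF V] by auto
next
  case False
  note [simp] = subsetD[OF closed_subspaceD(1)[OF V]] closed_subspaceD(2-4)[OF V]
  define c where "c = hinner E (x \<ominus> p) v / hinner E v v"
  have "x \<ominus> (p \<oplus> c \<odot> v) = (x \<ominus> p) \<ominus> c \<odot> v"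
    using x p v by (simp add: a_minus_def M.minus_add M.a_assoc)
  then have "(hnorm E (x \<ominus> p))\<^sup>2 \<le> (hnorm E ((x \<ominus> p) \<ominus> c \<odot> v))\<^sup>2"
    using min[of "p \<oplus> c \<odot> v"] p v by (simp add: power_mono)
  also have "\<dots> = (hnorm E (x \<ominus> p))\<^sup>2 - (norm (hinner E (x \<ominus> p) v))\<^sup>2 / (hnorm E v)\<^sup>2"
    unfolding c_def using x p v False by (intro hnorm_residual_sq) auto
  finally show ?thesis
    using False v by (simp add: divide_le_0_iff hnorm_eq_zero_iff)
qed

lemma
  assumes V: "closed_subspace E V" and x: "x \<in> carrier E"
  shows hproj_mem: "hproj E V x \<in> V"
    and hproj_orthogonal: "v \<in> V \<Longrightarrow> hinner E (x \<ominus> hproj E V x) v = 0"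
proof -
  note [simp] = subsetD[OF closed_subspaceD(1)[OF V]] closed_subspaceD(2-4)[OF V]
  let ?P = "\<lambda>p. p \<in> V \<and> (\<forall>v\<in>V. hinner E (x \<ominus> p) v = 0)"
  obtain p where p: "?P p"
    using ex_closest_point[OF V x] closest_point_orthogonal[OF V x] by blast
  have "q = p" if q: "?P q" for q
  proof -
    have "hinner E (q \<ominus> p) (q \<ominus> p) = hinner E ((x \<ominus> p) \<ominus> (x \<ominus> q)) (q \<ominus> p)"
      using x p q by (simp add: diff_diff_diff)
    also have "\<dots> = 0"
      using x p q by (subst hinner_diff_left) auto
    finally show ?thesis
      using hinner_eq_zero[of "q \<ominus> p"] p q by (simp add: diff_eq_zero_iff)
  qed
  with p have "?P (hproj E V x)"
    unfolding hproj_def by (rule theI)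
  then show "hproj E V x \<in> V" and "v \<in> V \<Longrightarrow> hinner E (x \<ominus> hproj E V x) v = 0"
    by auto
qed

lemma hproj_carrier: "closed_subspace E V \<Longrightarrow> x \<in> carrier E \<Longrightarrow> hproj E V x \<in> carrier E"
  using hproj_mem closed_subspaceD(1) by blast

lemma hproj_self_adjoint:
  assumes V: "closed_subspace E V" and x: "x \<in> carrier E" and y: "y \<in> carrier E"
  shows "hinner E (hproj E V x) y = hinner E x (hproj E V y)"
proof -
  let ?p = "hproj E V x" and ?q = "hproj E V y"
  have [simp]: "?p \<in> carrier E" "?q \<in> carrier E" using hproj_carrier V x y by auto
  have "hinner E x ?q = hinner E ?p ?q"
    using hproj_orthogonal[OF V x hproj_mem[OF V y]] x by (simp add: hinner_diff_left)
  moreover have "hinner E (y \<ominus> ?q) ?p = 0"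
    using hproj_orthogonal[OF V y hproj_mem[OF V x]] .
  then have "hinner E ?p (y \<ominus> ?q) = 0"
    using hinner_commute[of ?p "y \<ominus> ?q"] y by simp
  then have "hinner E ?p y = hinner E ?p ?q"
    using y by (simp add: hinner_diff_right)
  ultimately show ?thesis by simp
qed

section \<open>Adjoint operators\<close>

text \<open>
  The kernel \<open>N\<close> of a nonzero bounded functional \<open>\<phi>\<close> is a closed subspace, so there is some
  \<open>u \<bottom> N\<close> with \<open>\<phi> u \<noteq> 0\<close>. Since \<open>\<phi> x \<odot> u \<ominus> \<phi> u \<odot> x\<close> lies in \<open>N\<close>, it is orthogonal to \<open>u\<close>, and this
  identity expresses \<open>\<phi> x\<close> as the inner product of \<open>x\<close> with a multiple of \<open>u\<close>.
\<close>

lemma ex_riesz_representation: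
  fixes \<phi> :: "'a \<Rightarrow> 'k"
  assumes add: "\<And>x y. \<lbrakk>x \<in> carrier E; y \<in> carrier E\<rbrakk> \<Longrightarrow> \<phi> (x \<oplus> y) = \<phi> x + \<phi> y"
    and smult: "\<And>c x. x \<in> carrier E \<Longrightarrow> \<phi> (c \<odot> x) = c * \<phi> x"
    and bounded: "\<And>x. x \<in> carrier E \<Longrightarrow> norm (\<phi> x) \<le> M * hnorm E x"
  shows "\<exists>z\<in>carrier E. \<forall>x\<in>carrier E. \<phi> x = hinner E x z"
proof (cases "\<forall>x\<in>carrier E. \<phi> x = 0")
  case True
  then show ?thesis by (intro bexI[of _ \<zero>]) auto
next
  case False
  then obtain x0 where x0: "x0 \<in> carrier E" "\<phi> x0 \<noteq> 0" by auto
  have minus: "\<phi> (\<ominus> x) = - \<phi> x" if "x \<in> carrier E" for x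
    using smult[of x "-1"] that by (simp add: smult_minus_one)
  have diff: "\<phi> (x \<ominus> y) = \<phi> x - \<phi> y" if "x \<in> carrier E" "y \<in> carrier E" for x y
    using that by (simp add: a_minus_def add minus)
  have zero: "\<phi> \<zero> = 0" using smult[of \<zero> 0] by simp
  define N where "N = {x \<in> carrier E. \<phi> x = 0}"
  have "submodule N (ring_of_type_algebra :: 'k ring) E"
    by (intro submoduleI) (auto simp: N_def add smult minus zero)
  moreover have "closedin met.mtopology N"
    unfolding met.metric_closedin_iff_sequentially_closed
  proof (intro conjI allI impI)
    fix s l assume s: "range s \<subseteq> N \<and> limitin met.mtopology s l sequentially"
    then have l: "l \<in> carrier E" and lim: "(\<lambda>n. hdist E (s n) l) \<longlonglongrightarrow> 0"
      by (auto simp: met.limitin_metric_dist_null)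
    have sN: "s n \<in> carrier E" "\<phi> (s n) = 0" for n using s by (auto simp: N_def)
    have "norm (\<phi> l) \<le> M * hdist E (s n) l" for n
      using bounded[of "s n \<ominus> l"] sN[of n] l by (simp add: diff hdist_def)
    then have "norm (\<phi> l) \<le> M * 0"
      using LIMSEQ_le_const[OF tendsto_mult_left[OF lim, of M]] by blast
    then show "l \<in> N" using l by (simp add: N_def)
  qed (auto simp: N_def)
  ultimately have N: "closed_subspace E N"
    by (simp add: closed_subspace_def htopology_eq)
  define u where "u = x0 \<ominus> hproj E N x0"
  have pN: "hproj E N x0 \<in> N" using hproj_mem[OF N] x0 by simp
  have u: "u \<in> carrier E" and \<phi>u: "\<phi> u \<noteq> 0"
    using x0 pN by (auto simp: u_def N_def diff)
  then have uu: "hinner E u u \<noteq> 0"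
    using hinner_eq_zero[of u] zero by auto
  define z where "z = rc_cnj (\<phi> u / hinner E u u) \<odot> u"
  have "\<phi> x = hinner E x z" if x: "x \<in> carrier E" for x
  proof -
    have "\<phi> x \<odot> u \<ominus> \<phi> u \<odot> x \<in> N"
      using x u by (simp add: N_def diff smult)
    then have "hinner E u (\<phi> x \<odot> u \<ominus> \<phi> u \<odot> x) = 0"
      unfolding u_def using hproj_orthogonal[OF N] x0 by blast
    then have "hinner E (\<phi> x \<odot> u \<ominus> \<phi> u \<odot> x) u = 0"
      using x u hinner_commute[of "\<phi> x \<odot> u \<ominus> \<phi> u \<odot> x" u] by simp
    then have "\<phi> x * hinner E u u = \<phi> u * hinner E x u"
      using x u by (simp add: hinner_diff_left hinner_smult_left)
    then have "\<phi> x = \<phi> u / hinner E u u * hinner E x u"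
      using uu by (simp add: eq_divide_eq)
    also have "\<dots> = hinner E x z"
      unfolding z_def using x u by (simp only: hinner_smult_right rc_cnj_rc_cnj)
    finally show ?thesis .
  qed
  moreover have "z \<in> carrier E" using u by (simp add: z_def)
  ultimately show ?thesis by blast
qed

lemma
  fixes G :: "('k, 'b) hspace"
  assumes "hilbert_space G" and T: "bounded_op E G T" and y: "y \<in> carrier G"
  shows hadjoint_carrier: "hadjoint E G T y \<in> carrier E"
    and hinner_hadjoint: "x \<in> carrier E \<Longrightarrow> hinner G (T x) y = hinner E x (hadjoint E G T y)"
proof -
  interpret G: hilbert_space G by fact
  let ?P = "\<lambda>z. z \<in> carrier E \<and> (\<forall>x\<in>carrier E. hinner G (T x) y = hinner E x z)"
  from T obtain M where T_carrier: "\<And>x. x \<in> carrier E \<Longrightarrow> T x \<in> carrier G"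
    and T_add: "\<And>x y. \<lbrakk>x \<in> carrier E; y \<in> carrier E\<rbrakk> \<Longrightarrow> T (x \<oplus> y) = T x \<oplus>\<^bsub>G\<^esub> T y"
    and T_smult: "\<And>c x. x \<in> carrier E \<Longrightarrow> T (c \<odot> x) = c \<odot>\<^bsub>G\<^esub> T x"
    and M: "\<And>x. x \<in> carrier E \<Longrightarrow> hnorm G (T x) \<le> M * hnorm E x"
    unfolding bounded_op_def Pi_iff by metis
  have "norm (hinner G (T x) y) \<le> (M * hnorm G y) * hnorm E x" if x: "x \<in> carrier E" for x
  proof -
    have "norm (hinner G (T x) y) \<le> hnorm G (T x) * hnorm G y"
      using G.hinner_Cauchy_Schwarz T_carrier x y by blast
    also have "\<dots> \<le> M * hnorm E x * hnorm G y"
      by (intro mult_right_mono M x) simp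
    finally show ?thesis by (simp add: mult_ac)
  qed
  then obtain z where z: "?P z"
    using ex_riesz_representation[of "\<lambda>x. hinner G (T x) y" "M * hnorm G y"] y
    by (auto simp: T_carrier T_add T_smult G.hinner_add_left G.hinner_smult_left)
  have "w = z" if w: "?P w" for w
  proof -
    have "hinner E (w \<ominus> z) w = hinner E (w \<ominus> z) z"
      using w z by (metis M.minus_closed)
    then have "hinner E (w \<ominus> z) (w \<ominus> z) = 0"
      using w z by (simp add: hinner_diff_right)
    then show ?thesis using w z hinner_eq_zero[of "w \<ominus> z"] by (simp add: diff_eq_zero_iff)
  qed
  with z have "?P (hadjoint E G T y)"
    unfolding hadjoint_def by (rule theI)
  then show "hadjoint E G T y \<in> carrier E" 
    and "x \<in> carrier E \<Longrightarrow> hinner G (T x) y = hinner E x (hadjoint E G T y)"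
    by auto
qed

section \<open>Unconditional sums\<close>

lemma hinner_finsum_left:
  assumes "finite F" "g \<in> F \<rightarrow> carrier E" "y \<in> carrier E"
  shows "hinner E (finsum E g F) y = (\<Sum>i\<in>F. hinner E (g i) y)"
  using assms by (induction F rule: finite_induct) (auto simp: hinner_add_left Pi_iff)

lemma has_hsum_unique:
  assumes "has_hsum E g J s" shows "hsum E g J = s"
  unfolding hsum_def
  using assms met.limitin_metric_unique[OF _ _ finite_subsets_at_top_neq_bot]
  by (intro the_equality) (simp_all add: has_hsum_def htopology_eq, blast)

lemma has_hsum_hnorm_le:
  assumes s: "has_hsum E g J s"
    and bound: "\<And>F. finite F \<Longrightarrow> F \<subseteq> J \<Longrightarrow> hnorm E (finsum E g F) \<le> b"
  shows "hnorm E s \<le> b"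
proof (rule field_le_epsilon)
  fix e :: real assume "0 < e"
  with s have sc: "s \<in> carrier E"
    by (auto simp: has_hsum_def htopology_eq met.limitin_metric)
  from s \<open>0 < e\<close> have
    "\<forall>\<^sub>F F in finite_subsets_at_top J. finsum E g F \<in> carrier E \<and> hdist E (finsum E g F) s < e"
    by (auto simp: has_hsum_def htopology_eq met.limitin_metric)
  moreover have "\<forall>\<^sub>F F in finite_subsets_at_top J. finite F \<and> F \<subseteq> J"
    by (rule eventually_finite_subsets_at_top_weakI) simp
  ultimately have "\<forall>\<^sub>F F in finite_subsets_at_top J. (finsum E g F \<in> carrier E \<and> hdist E (finsum E g F) s < e)
    \<and> (finite F \<and> F \<subseteq> J)"
    by (rule eventually_conj)
  then obtain F where F: "finite F" "F \<subseteq> J" and S: "finsum E g F \<in> carrier E"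
    and d: "hdist E (finsum E g F) s < e"
    using eventually_happens'[OF finite_subsets_at_top_neq_bot] by blast
  let ?S = "finsum E g F"
  have "hnorm E s \<le> hnorm E (s \<ominus> ?S) + hnorm E ?S"
    using hnorm_triangle[of "s \<ominus> ?S" ?S] sc S
    by (simp add: a_minus_def M.a_assoc M.l_neg)
  also have "\<dots> \<le> e + b"
    using d bound[OF F] sc S by (simp add: hdist_def hnorm_minus_commute)
  finally show "hnorm E s \<le> b + e" by simp
qed

end

lemma sum_le_infsum_ennreal:
  fixes a :: "'i \<Rightarrow> real"
  assumes "finite F" "F \<subseteq> J" and nonneg: "\<And>j. j \<in> J \<Longrightarrow> 0 \<le> a j"
    and le: "(\<Sum>\<^sub>\<infinity>j\<in>J. ennreal (a j)) \<le> ennreal K" and "0 \<le> K"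
  shows "(\<Sum>j\<in>F. a j) \<le> K"
proof -
  have "ennreal (\<Sum>j\<in>F. a j) = (\<Sum>\<^sub>\<infinity>j\<in>F. ennreal (a j))"
    using assms by (auto simp: subset_iff sum_ennreal)
  also have "\<dots> \<le> (\<Sum>\<^sub>\<infinity>j\<in>J. ennreal (a j))"
    using assms by (intro infsum_mono_neutral nonneg_summable_on_complete) auto
  also note le
  finally show ?thesis using \<open>0 \<le> K\<close> by simp
qed

section \<open>The synthesis estimate\<close>

context hilbert_space
begin

text \<open>
  One term of \<open>\<langle>S, y\<rangle>\<close>: the projection is self-adjoint and the adjoint turns into \<open>\<Lambda> j\<close>, so the
  term becomes an inner product in \<open>Hs j\<close>.
\<close>

lemma norm_hinner_weighted_op_le:
  fixes Hs :: "int \<Rightarrow> ('k, 'b) hspace"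
  assumes G: "hilbert_space (Hs j)" and W: "closed_subspace E (W j)" 
    and L: "bounded_op E (Hs j) (\<Lambda> j)" and T: "bounded_op E (Hs j) (T j)"
    and f: "f \<in> carrier E" and y: "y \<in> carrier E"
  shows "norm (hinner E (weighted_op E Hs W \<Lambda> v T j f) y)
    \<le> (v j)\<^sup>2 * (hnorm (Hs j) (\<Lambda> j (hproj E (W j) y)) * hnorm (Hs j) (T j f))"
proof -
  interpret G: hilbert_space "Hs j" by fact
  have Tf: "T j f \<in> carrier (Hs j)" using T f by (auto simp: bounded_op_def)
  let ?a = "hadjoint E (Hs j) (\<Lambda> j) (T j f)"
  let ?p = "hproj E (W j) y"
  have a: "?a \<in> carrier E" by (rule hadjoint_carrier[OF G L Tf])
  have p: "?p \<in> carrier E" by (rule hproj_carrier[OF W y])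
  have Lp: "\<Lambda> j ?p \<in> carrier (Hs j)" using L p by (auto simp: bounded_op_def)
  have "hinner E (weighted_op E Hs W \<Lambda> v T j f) y = of_real ((v j)\<^sup>2) * hinner E ?a ?p"
    unfolding weighted_op_def
    using hinner_smult_left[OF hproj_carrier[OF W a] y] hproj_self_adjoint[OF W a y] by simp
  also have "hinner E ?a ?p = rc_cnj (hinner (Hs j) (\<Lambda> j ?p) (T j f))"
    using hinner_commute[OF a p] hinner_hadjoint[OF G L Tf p] by simp
  finally have "norm (hinner E (weighted_op E Hs W \<Lambda> v T j f) y)
      = (v j)\<^sup>2 * norm (hinner (Hs j) (\<Lambda> j ?p) (T j f))"
    by (simp add: norm_mult norm_power)
  also have "\<dots> \<le> (v j)\<^sup>2 * (hnorm (Hs j) (\<Lambda> j ?p) * hnorm (Hs j) (T j f))"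
    by (intro mult_left_mono G.hinner_Cauchy_Schwarz Lp Tf) simp
  finally show ?thesis .
qed

text \<open>
  The Bessel hypothesis is applied to the sum \<open>S\<close> itself, which puts a factor \<open>\<parallel>S\<parallel>\<^sup>2\<close> on both sides
  of \<open>\<parallel>S\<parallel>\<^sup>4 \<le> D \<parallel>S\<parallel>\<^sup>2 K\<close>, where \<open>K\<close> is the weighted square sum of the \<open>T j f\<close>. Cancelling it
  needs \<open>S\<close> to be nonzero.
\<close>

lemma synthesis_bound:
  fixes Hs :: "int \<Rightarrow> ('k, 'b) hspace"
  assumes F: "finite F" and D: "0 \<le> D" and G: "\<And>j. j \<in> F \<Longrightarrow> hilbert_space (Hs j)" 
    and W: "\<And>j. j \<in> F \<Longrightarrow> closed_subspace E (W j)" 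
    and L: "\<And>j. j \<in> F \<Longrightarrow> bounded_op E (Hs j) (\<Lambda> j)"
    and T: "\<And>j. j \<in> F \<Longrightarrow> bounded_op E (Hs j) (T j)"
    and f: "f \<in> carrier E" 
    and g: "(\<lambda>j. weighted_op E Hs W \<Lambda> v T j f) \<in> F \<rightarrow> carrier E"
    and bessel: "\<And>y. y \<in> carrier E \<Longrightarrow> 
      (\<Sum>j\<in>F. (v j)\<^sup>2 * (hnorm (Hs j) (\<Lambda> j (hproj E (W j) y)))\<^sup>2) \<le> D * (hnorm E y)\<^sup>2"
  shows "(hnorm E (finsum E (\<lambda>j. weighted_op E Hs W \<Lambda> v T j f) F))\<^sup>2
    \<le> D * (\<Sum>j\<in>F. (v j)\<^sup>2 * (hnorm (Hs j) (T j f))\<^sup>2)"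
proof -
  let ?g = "\<lambda>j. weighted_op E Hs W \<Lambda> v T j f"
  define S where "S = finsum E ?g F"
  define K where "K = (\<Sum>j\<in>F. (v j)\<^sup>2 * (hnorm (Hs j) (T j f))\<^sup>2)"
  let ?a = "\<lambda>j. v j * hnorm (Hs j) (\<Lambda> j (hproj E (W j) S))"
  let ?b = "\<lambda>j. v j * hnorm (Hs j) (T j f)"
  have S: "S \<in> carrier E" unfolding S_def using g by (rule M.finsum_closed)
  have K: "0 \<le> K" by (auto simp: K_def intro: sum_nonneg)
  have "(hnorm E S)\<^sup>2 = norm (hinner E S S)" by (simp add: hnorm_def)
  also have "\<dots> = norm (\<Sum>j\<in>F. hinner E (?g j) S)"
    unfolding S_def using hinner_finsum_left[OF F g S[unfolded S_def]] by simp
  also have "\<dots> \<le> (\<Sum>j\<in>F. norm (hinner E (?g j) S))"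
    by (rule norm_sum)
  also have "\<dots> \<le> (\<Sum>j\<in>F. ?a j * ?b j)"
  proof (rule sum_mono)
    fix j assume "j \<in> F"
    then show "norm (hinner E (?g j) S) \<le> ?a j * ?b j"
      using norm_hinner_weighted_op_le[of Hs j W \<Lambda> T f S v] G W L T f S
      by (simp add: power2_eq_square mult_ac)
  qed
  finally have "((hnorm E S)\<^sup>2)\<^sup>2 \<le> (\<Sum>j\<in>F. ?a j * ?b j)\<^sup>2"
    by (intro power_mono) simp_all
  also have "\<dots> \<le> (\<Sum>j\<in>F. (?a j)\<^sup>2) * (\<Sum>j\<in>F. (?b j)\<^sup>2)"
    by (rule Cauchy_Schwarz_ineq_sum)
  also have "\<dots> \<le> (D * (hnorm E S)\<^sup>2) * K"
    using bessel[OF S] K by (simp add: power_mult_distrib K_def mult_right_mono)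
  finally have main: "(hnorm E S)\<^sup>2 * (hnorm E S)\<^sup>2 \<le> (D * K) * (hnorm E S)\<^sup>2"
    by (simp add: power2_eq_square mult_ac)
  show ?thesis
  proof (cases "hnorm E S = 0")
    case False
    then have "0 < (hnorm E S)\<^sup>2" by simp
    with main have "(hnorm E S)\<^sup>2 \<le> D * K" by (rule mult_right_le_imp_le)
    then show ?thesis by (simp add: S_def K_def)
  next
    case True
    with D K show ?thesis by (simp add: S_def K_def)
  qed
qed

end

theorem theorem3p2:
  fixes H :: "('k::rc_field, 'a) hspace"
    and J :: "int set"
    and Hs :: "int \<Rightarrow> ('k, 'b) hspace"
    and W :: "int \<Rightarrow> 'a set"
    and \<Lambda> T :: "int \<Rightarrow> 'a \<Rightarrow> 'b"
    and v :: "int \<Rightarrow> real"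
    and C D :: real
  assumes "hilbert_space H" and "separable_space (htopology H)"
    and "\<And>j. j \<in> J \<Longrightarrow> hilbert_space (Hs j)"
    and "g_fusion_frame H J Hs W \<Lambda> v C D"
    and "\<And>j. j \<in> J \<Longrightarrow> bounded_op H (Hs j) (T j)"
    and "resolution_of_identity H J (weighted_op H Hs W \<Lambda> v T)"
  shows "\<forall>f\<in>carrier H.
    ennreal (1 / D * (hnorm H (hsum H (\<lambda>j. weighted_op H Hs W \<Lambda> v T j f) J))\<^sup>2)
      \<le> (\<Sum>\<^sub>\<infinity>j\<in>J. ennreal ((v j)\<^sup>2 * (hnorm (Hs j) (T j f))\<^sup>2))"
proof
  fix f assume f: "f \<in> carrier H"
  interpret hilbert_space H by fact
  let ?g = "\<lambda>j. weighted_op H Hs W \<Lambda> v T j f"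
  let ?t = "\<lambda>j. (v j)\<^sup>2 * (hnorm (Hs j) (T j f))\<^sup>2"
  have W: "\<And>j. j \<in> J \<Longrightarrow> closed_subspace H (W j)"
    and L: "\<And>j. j \<in> J \<Longrightarrow> bounded_op H (Hs j) (\<Lambda> j)"
    and D: "0 < D"
    and upper: "\<And>y. y \<in> carrier H \<Longrightarrow> 
      (\<Sum>\<^sub>\<infinity>j\<in>J. ennreal ((v j)\<^sup>2 * (hnorm (Hs j) (\<Lambda> j (hproj H (W j) y)))\<^sup>2))
        \<le> ennreal (D * (hnorm H y)\<^sup>2)"
    using assms(4) by (auto simp: g_fusion_frame_def)
  have sum: "has_hsum H ?g J f"
    using assms(6) f by (auto simp: resolution_of_identity_def)
  show "ennreal (1 / D * (hnorm H (hsum H ?g J))\<^sup>2) \<le> (\<Sum>\<^sub>\<infinity>j\<in>J. ennreal (?t j))"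
  proof (cases "\<Sum>\<^sub>\<infinity>j\<in>J. ennreal (?t j)")
    case (real K)
    have "hnorm H (finsum H ?g F) \<le> sqrt (D * K)" if F: "finite F" "F \<subseteq> J" for F
    proof (rule real_le_rsqrt)
      have "(\<Sum>j\<in>F. (v j)\<^sup>2 * (hnorm (Hs j) (\<Lambda> j (hproj H (W j) y)))\<^sup>2) \<le> D * (hnorm H y)\<^sup>2"
        if "y \<in> carrier H" for y
        using sum_le_infsum_ennreal[OF F _ upper[OF that]] D by simp
      then have "(hnorm H (finsum H ?g F))\<^sup>2 \<le> D * (\<Sum>j\<in>F. ?t j)"
        using F D assms(3,5) W L f sum by (intro synthesis_bound) (auto simp: has_hsum_def)
      also have "\<dots> \<le> D * K"
        using sum_le_infsum_ennreal[OF F, of ?t K] D real by (intro mult_left_mono) auto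
      finally show "(hnorm H (finsum H ?g F))\<^sup>2 \<le> D * K" .
    qed
    then have "hnorm H f \<le> sqrt (D * K)"
      by (rule has_hsum_hnorm_le[OF sum])
    then have "(hnorm H f)\<^sup>2 \<le> (sqrt (D * K))\<^sup>2"
      by (intro power_mono) simp_all
    then have "1 / D * (hnorm H f)\<^sup>2 \<le> K"
      using D real by (simp add: field_simps)
    then show ?thesis
      using real by (simp add: has_hsum_unique[OF sum] ennreal_leI)
  qed simp
qed

end
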